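(* Let $\mathcal{H}$ be a real Hilbert space and $\mathcal{D}\subset\mathcal{H}$ a dictionary with $\|g\|=1$ for all $g\in\mathcal{D}$. Let $f\in\mathcal{H}$. (i) Let $(f_k)_{k\ge0}$ be any sequence generated by the relaxed greedy algorithm (RGA) applied to $f$ with $\alpha_1=0$ and $\alpha_k=1-\frac2k$ for $k>1$, and let $r_k=f-f_k$. Then for every $h\in\mathcal{L}_1$, $$\|r_N\|^2\le\|f-h\|^2+4\left(\|h\|_{\mathcal{L}_1}^2-\|h\|^2\right)N^{-1},\qquad N=1,2,\ldots,$$ and therefore $$\|r_N\|\le K(f,2N^{-1/2},\mathcal{H},\mathcal{L}_1)\le 2K(f,N^{-1/2},\mathcal{H},\mathcal{L}_1),\qquad N=1,2,\ldots.$$ (ii) Let instead $(f_k)_{k\ge0}$ be any sequence generated by the RGA applied to $f$ with $\alpha_k=1-\frac1k$ for $k\ge1$, and let $r_k=f-f_k$. Then for every $h\in\mathcal{L}_1$, $$\|r_N\|\le\|f-h\|+\left(\|h\|_{\mathcal{L}_1}^2-\|h\|^2\right)^{1/2}N^{-1/2},\qquad N=1,2,\ldots,$$ and therefore $$\|r_N\|\le K(f,N^{-1/2},\mathcal{H},\mathcal{L}_1),\qquad N=1,2,\ldots.$$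
   Context: A dictionary is any family of elements of $\mathcal{H}$; here all are normalized to $\|g\|=1$. $\mathcal{L}_1=\mathcal{L}_1(\mathcal{D})$ is the set of $f\in\mathcal{H}$ admitting an expansion $f=\sum_{g\in\mathcal{D}}c_g g$ with $\sum_g|c_g|<\infty$, with norm $\|f\|_{\mathcal{L}_1}=\inf\{\sum_{g}|c_g| : f=\sum_{g}c_g g\}$. RGA with prescribed sequence $(\alpha_k)_{k\ge1}$: set $f_0=0$; for $k\ge1$ put $f_k=\alpha_kf_{k-1}+\beta_kg_k$, where $(\beta_k,g_k)\in\mathbb{R}\times\mathcal{D}$ is a minimizer of $(\beta,g)\mapsto\|f-\alpha_kf_{k-1}-\beta g\|$ over $\mathbb{R}\times\mathcal{D}$. $K$-functional: for $t>0$, $K(f,t,\mathcal{H},\mathcal{L}_1)=\inf_{h\in\mathcal{L}_1}\{\|f-h\|+t\|h\|_{\mathcal{L}_1}\}$. *)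

theory Defs
  imports "HOL-Analysis.Analysis"
begin

text \<open>
  A real Hilbert space is a type of class \<open>{real_inner, complete_space}\<close>; a dictionary is a set of
  vectors in it, possibly uncountable, so expansions over it are unordered sums.
\<close>

definition L1_expansion :: "'a::{real_inner, complete_space} set \<Rightarrow> 'a \<Rightarrow> ('a \<Rightarrow> real) \<Rightarrow> bool" where
  "L1_expansion D f c \<longleftrightarrow>
     (\<lambda>g. \<bar>c g\<bar>) summable_on D \<and> ((\<lambda>g. c g *\<^sub>R g) has_sum f) D"

definition L1_space :: "'a::{real_inner, complete_space} set \<Rightarrow> 'a set" where
  "L1_space D = {f. \<exists>c. L1_expansion D f c}"

text \<open>Only meaningful for \<open>f \<in> L1_space D\<close>; otherwise the infimum is over the empty set.\<close>

definition L1_norm :: "'a::{real_inner, complete_space} set \<Rightarrow> 'a \<Rightarrow> real" where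
  "L1_norm D f = Inf {\<Sum>\<^sub>\<infinity>g\<in>D. \<bar>c g\<bar> | c. L1_expansion D f c}"

definition K_functional :: "'a::{real_inner, complete_space} set \<Rightarrow> 'a \<Rightarrow> real \<Rightarrow> real" where
  "K_functional D f t = (INF h\<in>L1_space D. norm (f - h) + t * L1_norm D h)"

text \<open>
  \<open>fs\<close> is one possible output of the algorithm: minimizers need be neither unique nor existent,
  hence a relation rather than a function. The value \<open>\<alpha> 0\<close> is never used.
\<close>

definition RGA_sequence ::
    "'a::{real_inner, complete_space} set \<Rightarrow> (nat \<Rightarrow> real) \<Rightarrow> 'a \<Rightarrow> (nat \<Rightarrow> 'a) \<Rightarrow> bool" where
  "RGA_sequence D \<alpha> f fs \<longleftrightarrow>
     fs 0 = 0 \<and>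
     (\<forall>k\<ge>1. \<exists>\<beta> g.
        is_arg_min (\<lambda>(b, u). norm (f - \<alpha> k *\<^sub>R fs (k - 1) - b *\<^sub>R u)) (\<lambda>p. p \<in> UNIV \<times> D) (\<beta>, g) \<and>
        fs k = \<alpha> k *\<^sub>R fs (k - 1) + \<beta> *\<^sub>R g)"

end

(*
The pair (beta, g) chosen by the algorithm does at least as well as ((1 - alpha) * S * sgn (c g), g)
for every g in D, where h has the expansion with coefficients c and S = sum |c g|.  Averaging the
corresponding squared errors over g with weights |c g| / S gives the one-step estimate
  |r_k|^2 <= |alpha_k r_(k-1) + (1 - alpha_k)(f - h)|^2 + (1 - alpha_k)^2 (S^2 - |h|^2),
where S may then be replaced by the L1 norm of h.  Both rates follow by induction on k, using
convexity of the squared norm in (i) and the triangle inequality in (ii).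
*)
theory Submission
  imports Defs
begin

section \<open>Expansions and the L1 norm\<close>

lemma L1_expansion_inner:
  assumes "L1_expansion D h c"
  shows "((\<lambda>g. c g * inner u g) has_sum inner u h) D"
proof -
  have "((\<lambda>g. c g *\<^sub>R g) has_sum h) D"
    using assms by (simp add: L1_expansion_def)
  then have "((\<lambda>g. inner u (c g *\<^sub>R g)) has_sum inner u h) D"
    by (rule has_sum_bounded_linear[OF bounded_linear_inner_right, unfolded o_def])
  then show ?thesis by simp
qed

lemma L1_expansion_abs:
  assumes "L1_expansion D h c"
  shows "((\<lambda>g. \<bar>c g\<bar>) has_sum (\<Sum>\<^sub>\<infinity>g\<in>D. \<bar>c g\<bar>)) D"
  using assms by (simp add: L1_expansion_def)

text \<open>Bounding each \<open>inner h g\<close> by \<open>norm h\<close> in the series for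
  \<open>inner h h\<close> keeps the comparison between sums of reals; one factor
  \<open>norm h\<close> is then cancelled.\<close>

lemma norm_le_L1_expansion:
  assumes D: "\<forall>g\<in>D. norm g = 1" and c: "L1_expansion D h c"
  shows "norm h \<le> (\<Sum>\<^sub>\<infinity>g\<in>D. \<bar>c g\<bar>)"
proof -
  let ?S = "\<Sum>\<^sub>\<infinity>g\<in>D. \<bar>c g\<bar>"
  have "inner h h \<le> ?S * norm h"
  proof (rule has_sum_mono[OF L1_expansion_inner[OF c] has_sum_cmult_left[OF L1_expansion_abs[OF c]]])
    fix g assume "g \<in> D"
    then have "\<bar>inner h g\<bar> \<le> norm h"
      using Cauchy_Schwarz_ineq2[of h g] D by simp
    then have "\<bar>c g * inner h g\<bar> \<le> \<bar>c g\<bar> * norm h"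
      by (simp add: abs_mult mult_left_mono)
    then show "c g * inner h g \<le> \<bar>c g\<bar> * norm h" by linarith
  qed
  then have "norm h * norm h \<le> ?S * norm h"
    by (simp add: dot_square_norm power2_eq_square)
  then show ?thesis
    by (cases "h = 0") (auto intro: infsum_nonneg)
qed

text \<open>Carries bounds from single expansions to the infimum, which need not be attained.
  Membership in \<open>L1_space D\<close> makes the set of sums nonempty.\<close>

lemma L1_norm_greatest:
  assumes "h \<in> L1_space D"
    and "\<And>c. L1_expansion D h c \<Longrightarrow> y \<le> (\<Sum>\<^sub>\<infinity>g\<in>D. \<bar>c g\<bar>)"
  shows "y \<le> L1_norm D h"
  unfolding L1_norm_def
  by (rule cInf_greatest) (use assms in \<open>auto simp: L1_space_def\<close>)

lemma norm_le_L1_norm: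
  assumes "\<forall>g\<in>D. norm g = 1" and "h \<in> L1_space D"
  shows "norm h \<le> L1_norm D h"
  using assms by (intro L1_norm_greatest norm_le_L1_expansion)

lemma L1_norm_nonneg:
  assumes "h \<in> L1_space D"
  shows "0 \<le> L1_norm D h"
  using assms by (intro L1_norm_greatest infsum_nonneg) auto

section \<open>The K-functional\<close>

lemma zero_mem_L1_space: "0 \<in> L1_space D"
  unfolding L1_space_def L1_expansion_def by (auto intro!: exI[of _ "\<lambda>_. 0"])

lemma K_functional_greatest:
  assumes "\<And>h. h \<in> L1_space D \<Longrightarrow> y \<le> norm (f - h) + t * L1_norm D h"
  shows "y \<le> K_functional D f t"
  unfolding K_functional_def
  by (rule cINF_greatest) (use assms zero_mem_L1_space in auto)

lemma K_functional_lower: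
  assumes "h \<in> L1_space D" and "0 \<le> t"
  shows "K_functional D f t \<le> norm (f - h) + t * L1_norm D h"
  unfolding K_functional_def
proof (rule cINF_lower)
  show "bdd_below ((\<lambda>h. norm (f - h) + t * L1_norm D h) ` L1_space D)"
    using assms(2) by (intro bdd_belowI2[where m = 0]) (simp add: L1_norm_nonneg)
qed fact

text \<open>Halving the objective at \<open>2 * t\<close> leaves weight \<open>t\<close> on the L1
  norm and only shrinks the other term, so the comparison holds for each \<open>h\<close>
  separately.\<close>

lemma K_functional_double:
  assumes "0 \<le> t"
  shows "K_functional D f (2 * t) \<le> 2 * K_functional D f t"
proof -
  have "K_functional D f (2 * t) / 2 \<le> K_functional D f t"
  proof (rule K_functional_greatest)
    fix h assume h: "h \<in> L1_space D"
    show "K_functional D f (2 * t) / 2 \<le> norm (f - h) + t * L1_norm D h"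
      using K_functional_lower[OF h, of "2 * t" f] assms norm_ge_zero[of "f - h"] by linarith
  qed
  then show ?thesis by simp
qed

section \<open>The one-step estimate\<close>

text \<open>A bias-variance identity: if g is drawn with probability \<open>|c g| / S\<close>, the
  vector \<open>(a * S * sgn (c g)) *\<^sub>R g\<close> has mean \<open>a *\<^sub>R h\<close> and
  norm \<open>|a| * S\<close>, so the mean squared error is the right-hand side. A lower bound
  \<open>P\<close> of all errors cannot exceed the mean.\<close>

lemma greedy_le_expansion:
  assumes D: "\<forall>g\<in>D. norm g = 1" and ne: "D \<noteq> {}" and c: "L1_expansion D h c"
    and P: "\<And>b g. g \<in> D \<Longrightarrow> P \<le> (norm (u - b *\<^sub>R g))\<^sup>2"
  shows "P \<le> (norm (u - a *\<^sub>R h))\<^sup>2 + a\<^sup>2 * ((\<Sum>\<^sub>\<infinity>g\<in>D. \<bar>c g\<bar>)\<^sup>2 - (norm h)\<^sup>2)"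
proof -
  define S where "S = (\<Sum>\<^sub>\<infinity>g\<in>D. \<bar>c g\<bar>)"
  have S0: "0 \<le> S" unfolding S_def by (rule infsum_nonneg) simp
  have exp: "(norm (u - b *\<^sub>R v))\<^sup>2 = (norm u)\<^sup>2 - 2 * b * inner u v + b\<^sup>2 * (norm v)\<^sup>2" for b v
    unfolding power2_norm_eq_inner
    by (simp add: inner_diff_left inner_diff_right inner_commute power2_eq_square)
  show ?thesis
  proof (cases "S = 0")
    \<comment> \<open>With no mass to average over, \<open>h\<close> vanishes, and the coefficient 0
      on any dictionary element gives the bound.\<close>
    case True
    then have "h = 0" using norm_le_L1_expansion[OF D c] by (simp add: S_def)
    moreover obtain g where "g \<in> D" using ne by blast
    ultimately show ?thesis using P[of g 0] True by (simp add: S_def)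
  next
    case False
    let ?q = "(norm u)\<^sup>2 + a\<^sup>2 * S\<^sup>2"
    have abs: "((\<lambda>g. \<bar>c g\<bar>) has_sum S) D"
      unfolding S_def by (rule L1_expansion_abs[OF c])
    have "S * P \<le> S * ?q + (- 2 * a * S) * inner u h"
    proof (rule has_sum_mono)
      show "((\<lambda>g. \<bar>c g\<bar> * P) has_sum S * P) D"
        by (rule has_sum_cmult_left[OF abs])
      show "((\<lambda>g. \<bar>c g\<bar> * ?q + (- 2 * a * S) * (c g * inner u g)) has_sum
              (S * ?q + (- 2 * a * S) * inner u h)) D"
        by (intro has_sum_add has_sum_cmult_left has_sum_cmult_right abs L1_expansion_inner c)
    next
      fix g assume g: "g \<in> D"
      show "\<bar>c g\<bar> * P \<le> \<bar>c g\<bar> * ?q + (- 2 * a * S) * (c g * inner u g)"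
      proof (cases "c g = 0")
        case nz: False
        define b where "b = a * S * sgn (c g)"
        \<comment> \<open>The weight \<open>|c g|\<close> absorbs the sign in \<open>b\<close>, so
          the cross terms become multiples of \<open>c g * inner u g\<close> and sum to a multiple
          of \<open>inner u h\<close>.\<close>
        have b2: "b\<^sup>2 = a\<^sup>2 * S\<^sup>2" and cb: "\<bar>c g\<bar> * b = a * S * c g"
          using nz by (auto simp: b_def power_mult_distrib sgn_if)
        have "\<bar>c g\<bar> * P \<le> \<bar>c g\<bar> * (norm (u - b *\<^sub>R g))\<^sup>2"
          by (rule mult_left_mono[OF P[OF g]]) simp
        also have "\<dots> = \<bar>c g\<bar> * ?q - 2 * (\<bar>c g\<bar> * b) * inner u g"
          using D g by (simp add: exp b2 algebra_simps)
        also have "\<dots> = \<bar>c g\<bar> * ?q + (- 2 * a * S) * (c g * inner u g)"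
          unfolding cb by simp
        finally show ?thesis .
      qed simp
    qed
    then have "S * P \<le> S * (?q - 2 * a * inner u h)"
      by (simp add: algebra_simps)
    then have "P \<le> ?q - 2 * a * inner u h"
      using S0 False by (simp add: mult_le_cancel_left_pos)
    then show ?thesis
      unfolding exp S_def[symmetric] by (simp add: algebra_simps)
  qed
qed

text \<open>Solving the inequality for the squared sum gives a threshold \<open>y\<close>
  independent of the expansion; \<open>a \<noteq> 0\<close> allows the division. Its root then
  bounds every sum, hence the infimum. Since \<open>sqrt\<close> is negative on negative reals, this
  is sound for either sign of \<open>y\<close>.\<close>

lemma greedy_le_L1_norm:
  assumes D: "\<forall>g\<in>D. norm g = 1" and ne: "D \<noteq> {}" and h: "h \<in> L1_space D" and a: "a \<noteq> 0"
    and P: "\<And>b g. g \<in> D \<Longrightarrow> P \<le> (norm (u - b *\<^sub>R g))\<^sup>2"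
  shows "P \<le> (norm (u - a *\<^sub>R h))\<^sup>2 + a\<^sup>2 * ((L1_norm D h)\<^sup>2 - (norm h)\<^sup>2)"
proof -
  define y where "y = (P - (norm (u - a *\<^sub>R h))\<^sup>2) / a\<^sup>2 + (norm h)\<^sup>2"
  have y_iff: "y \<le> z \<longleftrightarrow> P \<le> (norm (u - a *\<^sub>R h))\<^sup>2 + a\<^sup>2 * (z - (norm h)\<^sup>2)" for z
    using a by (simp add: y_def field_simps)
  have "sqrt y \<le> L1_norm D h"
  proof (rule L1_norm_greatest[OF h])
    fix c assume "L1_expansion D h c"
    then have "y \<le> (\<Sum>\<^sub>\<infinity>g\<in>D. \<bar>c g\<bar>)\<^sup>2"
      unfolding y_iff using greedy_le_expansion[OF D ne _ P] by blast
    then show "sqrt y \<le> (\<Sum>\<^sub>\<infinity>g\<in>D. \<bar>c g\<bar>)"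
      by (intro real_le_lsqrt infsum_nonneg) auto
  qed
  then show ?thesis
    unfolding y_iff[symmetric] by (rule sqrt_le_D)
qed

lemma RGA_step:
  assumes D: "\<forall>g\<in>D. norm g = 1" and h: "h \<in> L1_space D" and fs: "RGA_sequence D \<alpha> f fs"
    and k: "k \<ge> 1" and \<alpha>: "\<alpha> k \<noteq> 1"
  shows "(norm (f - fs k))\<^sup>2 \<le>
    (norm (\<alpha> k *\<^sub>R (f - fs (k - 1)) + (1 - \<alpha> k) *\<^sub>R (f - h)))\<^sup>2
      + (1 - \<alpha> k)\<^sup>2 * ((L1_norm D h)\<^sup>2 - (norm h)\<^sup>2)"
proof -
  define u where "u = f - \<alpha> k *\<^sub>R fs (k - 1)"
  obtain \<beta> g where
    min: "is_arg_min (\<lambda>(b, v). norm (u - b *\<^sub>R v)) (\<lambda>p. p \<in> UNIV \<times> D) (\<beta>, g)"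
    and fk: "fs k = \<alpha> k *\<^sub>R fs (k - 1) + \<beta> *\<^sub>R g"
    using fs k unfolding RGA_sequence_def u_def by blast
  have g: "g \<in> D" and le: "norm (f - fs k) \<le> norm (u - b *\<^sub>R v)" if "v \<in> D" for b v
    using min that by (auto simp: is_arg_min_linorder fk u_def algebra_simps)
  \<comment> \<open>The dictionary is nonempty because the algorithm has selected an element of
    it.\<close>
  have "D \<noteq> {}" using min by (auto simp: is_arg_min_def)
  moreover have "(norm (f - fs k))\<^sup>2 \<le> (norm (u - b *\<^sub>R v))\<^sup>2" if "v \<in> D" for b v
    using le[OF that] by (rule power_mono) simp
  ultimately have "(norm (f - fs k))\<^sup>2 \<le> (norm (u - (1 - \<alpha> k) *\<^sub>R h))\<^sup>2
      + (1 - \<alpha> k)\<^sup>2 * ((L1_norm D h)\<^sup>2 - (norm h)\<^sup>2)"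
    using D h \<alpha> by (intro greedy_le_L1_norm) auto
  \<comment> \<open>Splitting \<open>f\<close> with weights \<open>\<alpha> k\<close> and
    \<open>1 - \<alpha> k\<close> exposes the previous residual, which makes the estimate
    recursive.\<close>
  moreover have "u - (1 - \<alpha> k) *\<^sub>R h = \<alpha> k *\<^sub>R (f - fs (k - 1)) + (1 - \<alpha> k) *\<^sub>R (f - h)"
    by (simp add: u_def algebra_simps)
  ultimately show ?thesis by simp
qed

section \<open>The two convergence rates\<close>

lemma norm_convex_combination_square_le:
  fixes x y :: "'a::real_normed_vector"
  assumes "0 \<le> a" "a \<le> 1"
  shows "(norm (a *\<^sub>R x + (1 - a) *\<^sub>R y))\<^sup>2 \<le> a * (norm x)\<^sup>2 + (1 - a) * (norm y)\<^sup>2"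
proof -
  have "norm (a *\<^sub>R x + (1 - a) *\<^sub>R y) \<le> a * norm x + (1 - a) * norm y"
    using norm_triangle_ineq[of "a *\<^sub>R x" "(1 - a) *\<^sub>R y"] assms by simp
  then have "(norm (a *\<^sub>R x + (1 - a) *\<^sub>R y))\<^sup>2 \<le> (a * norm x + (1 - a) * norm y)\<^sup>2"
    by (rule power_mono) simp
  also have "\<dots> = a * (norm x)\<^sup>2 + (1 - a) * (norm y)\<^sup>2 - a * (1 - a) * (norm x - norm y)\<^sup>2"
    by (simp add: power2_eq_square algebra_simps)
  also have "\<dots> \<le> a * (norm x)\<^sup>2 + (1 - a) * (norm y)\<^sup>2"
    using assms by simp
  finally show ?thesis .
qed

lemma L1_norm_norm_gap_nonneg:
  assumes "\<forall>g\<in>D. norm g = 1" and "h \<in> L1_space D"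
  shows "0 \<le> (L1_norm D h)\<^sup>2 - (norm h)\<^sup>2"
  using norm_le_L1_norm[OF assms] by (simp add: power_mono)

lemma RGA_two_over_k_square_bound:
  assumes D: "\<forall>g\<in>D. norm g = 1" and h: "h \<in> L1_space D"
    and fs: "RGA_sequence D (\<lambda>k. if k = 1 then 0 else 1 - 2 / real k) f fs" and "N \<ge> 1"
  shows "(norm (f - fs N))\<^sup>2
    \<le> (norm (f - h))\<^sup>2 + 4 * ((L1_norm D h)\<^sup>2 - (norm h)\<^sup>2) * inverse (real N)"
  using \<open>N \<ge> 1\<close>
proof (induction N rule: dec_induct)
  case base
  \<comment> \<open>The first relaxation parameter is 0, so one step gives the bound with constant
    1, which is at most 4 because the gap is nonnegative.\<close>
  show ?case
    using RGA_step[OF D h fs, of 1] L1_norm_norm_gap_nonneg[OF D h] by simp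
next
  case (step n)
  define B where "B = (L1_norm D h)\<^sup>2 - (norm h)\<^sup>2"
  define e where "e = (norm (f - h))\<^sup>2"
  define a where "a = 1 - 2 / real (Suc n)"
  have B: "0 \<le> B" unfolding B_def by (rule L1_norm_norm_gap_nonneg[OF D h])
  have n: "real n \<ge> 1" using step by simp
  \<comment> \<open>The index \<open>Suc n\<close> is at least 2 here; at index 1 the formula would
    give -1, outside the convex range.\<close>
  have a: "0 \<le> a" "a \<le> 1" "a \<noteq> 1" using n by (auto simp: a_def field_simps)
  have "(norm (f - fs (Suc n)))\<^sup>2
      \<le> (norm (a *\<^sub>R (f - fs n) + (1 - a) *\<^sub>R (f - h)))\<^sup>2 + (1 - a)\<^sup>2 * B"
    using RGA_step[OF D h fs, of "Suc n"] step a by (simp add: a_def B_def)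
  also have "\<dots> \<le> a * (norm (f - fs n))\<^sup>2 + (1 - a) * e + (1 - a)\<^sup>2 * B"
    using norm_convex_combination_square_le[OF a(1,2)] by (simp add: e_def)
  also have "\<dots> \<le> a * (e + 4 * B * inverse (real n)) + (1 - a) * e + (1 - a)\<^sup>2 * B"
    using step.IH a by (simp add: mult_left_mono e_def B_def)
  also have "\<dots> = e + 4 * B * (a / real n + (1 - a)\<^sup>2 / 4)"
    by (simp add: field_simps)
  also have "\<dots> \<le> e + 4 * B * inverse (real (Suc n))"
  proof -
    \<comment> \<open>The constant 4 matches \<open>(1 - a)\<^sup>2 = 4 / (n + 1)\<^sup>2\<close>.
      The left side is (n - 1) / (n (n + 1)) + 1 / \<open>(n + 1)\<^sup>2\<close>, short of the
      right side by 1 / \<open>(n * (n + 1)\<^sup>2)\<close>.\<close>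
    have "a / real n + (1 - a)\<^sup>2 / 4 \<le> inverse (real (Suc n))"
      using n by (simp add: a_def divide_simps power2_eq_square) (simp add: algebra_simps)
    then show ?thesis using B by (simp add: mult_left_mono)
  qed
  finally show ?case unfolding e_def B_def .
qed

text \<open>Multiplied by the index, the weights become n and 1, so the scaled errors A satisfy
  \<open>A (n + 1)\<^sup>2 \<le> (A n + e)\<^sup>2 + B\<close>. This recursion preserves the bound
  \<open>n * e + sqrt (n * B)\<close>, and both sides vanish at 0.\<close>

lemma RGA_one_over_k_bound:
  assumes D: "\<forall>g\<in>D. norm g = 1" and h: "h \<in> L1_space D"
    and fs: "RGA_sequence D (\<lambda>k. 1 - 1 / real k) f fs"
  shows "real N * norm (f - fs N)
    \<le> real N * norm (f - h) + sqrt (real N * ((L1_norm D h)\<^sup>2 - (norm h)\<^sup>2))"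
proof (induction N)
  case 0
  show ?case by simp
next
  case (Suc n)
  define B where "B = (L1_norm D h)\<^sup>2 - (norm h)\<^sup>2"
  define e where "e = norm (f - h)"
  define m where "m = real (Suc n)"
  have B: "0 \<le> B" unfolding B_def by (rule L1_norm_norm_gap_nonneg[OF D h])
  have e: "0 \<le> e" and m: "0 < m" by (simp_all add: e_def m_def)
  let ?v = "(1 - 1 / m) *\<^sub>R (f - fs n) + (1 - (1 - 1 / m)) *\<^sub>R (f - h)"
  have mv: "m *\<^sub>R ?v = real n *\<^sub>R (f - fs n) + (f - h)"
  proof -
    have "m * (1 - 1 / m) = real n" "m * (1 - (1 - 1 / m)) = 1"
      using m by (simp_all add: m_def field_simps)
    then show ?thesis by (simp only: scaleR_add_right scaleR_scaleR scaleR_one)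
  qed
  have "m * norm ?v = norm (m *\<^sub>R ?v)" using m by simp
  also have "\<dots> \<le> real n * norm (f - fs n) + e"
    unfolding mv using norm_triangle_ineq[of "real n *\<^sub>R (f - fs n)" "f - h"] by (simp add: e_def)
  also have "\<dots> \<le> m * e + sqrt (real n * B)"
    using Suc.IH by (simp add: e_def B_def m_def algebra_simps)
  finally have v: "m * norm ?v \<le> m * e + sqrt (real n * B)" .
  have "(norm (f - fs (Suc n)))\<^sup>2 \<le> (norm ?v)\<^sup>2 + (1 / m)\<^sup>2 * B"
    using RGA_step[OF D h fs, of "Suc n"] by (simp add: m_def B_def)
  then have "m\<^sup>2 * (norm (f - fs (Suc n)))\<^sup>2 \<le> m\<^sup>2 * ((norm ?v)\<^sup>2 + (1 / m)\<^sup>2 * B)"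
    by (rule mult_left_mono) simp
  also have "\<dots> = (m * norm ?v)\<^sup>2 + B"
    using m by (simp add: power_mult_distrib power_divide distrib_left)
  also have "\<dots> \<le> (m * e + sqrt (real n * B))\<^sup>2 + B"
    using v m by (intro add_right_mono power_mono) auto
  also have "\<dots> = (m * e)\<^sup>2 + 2 * (m * e) * sqrt (real n * B) + m * B"
    using B by (simp add: power2_sum m_def algebra_simps)
  \<comment> \<open>The added \<open>B\<close> has already turned \<open>n * B\<close> into
    \<open>m * B\<close>; enlarging the cross term completes the square.\<close>
  also have "\<dots> \<le> (m * e)\<^sup>2 + 2 * (m * e) * sqrt (m * B) + m * B"
    using B e m by (intro add_mono mult_left_mono) (auto simp: m_def mult_right_mono)
  also have "\<dots> = (m * e + sqrt (m * B))\<^sup>2"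
    using B m by (simp add: power2_sum)
  finally have "(m * norm (f - fs (Suc n)))\<^sup>2 \<le> (m * e + sqrt (m * B))\<^sup>2"
    by (simp add: power_mult_distrib)
  then show ?case
    using power2_le_imp_le[of "m * norm (f - fs (Suc n))" "m * e + sqrt (m * B)"] B e m
    by (simp add: m_def e_def B_def)
qed

theorem theorem2p4:
  fixes D :: "'a::{real_inner, complete_space} set" and f :: 'a
  assumes "\<forall>g\<in>D. norm g = 1"
  shows
    "(\<forall>fs. RGA_sequence D (\<lambda>k. if k = 1 then 0 else 1 - 2 / real k) f fs \<longrightarrow>
        (\<forall>h\<in>L1_space D. \<forall>N\<ge>1.
           (norm (f - fs N))\<^sup>2
             \<le> (norm (f - h))\<^sup>2 + 4 * ((L1_norm D h)\<^sup>2 - (norm h)\<^sup>2) * inverse (real N)) \<and>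
        (\<forall>N\<ge>1.
           norm (f - fs N) \<le> K_functional D f (2 * real N powr (-1/2)) \<and>
           K_functional D f (2 * real N powr (-1/2)) \<le> 2 * K_functional D f (real N powr (-1/2)))) \<and>
     (\<forall>fs. RGA_sequence D (\<lambda>k. 1 - 1 / real k) f fs \<longrightarrow>
        (\<forall>h\<in>L1_space D. \<forall>N\<ge>1.
           norm (f - fs N)
             \<le> norm (f - h) + sqrt ((L1_norm D h)\<^sup>2 - (norm h)\<^sup>2) * real N powr (-1/2)) \<and>
        (\<forall>N\<ge>1. norm (f - fs N) \<le> K_functional D f (real N powr (-1/2))))"
proof (intro conjI allI impI ballI)
  fix N :: nat assume N: "N \<ge> 1"
  define t where "t = real N powr (-1/2)"
  have t_eq: "t = 1 / sqrt (real N)"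
    using N by (simp add: t_def powr_minus_divide powr_half_sqrt)
  then have t: "0 \<le> t" "t\<^sup>2 = inverse (real N)"
    by (auto simp: power_divide inverse_eq_divide)
  { fix fs assume fs: "RGA_sequence D (\<lambda>k. if k = 1 then 0 else 1 - 2 / real k) f fs"
    { fix h assume h: "h \<in> L1_space D"
      show "(norm (f - fs N))\<^sup>2
          \<le> (norm (f - h))\<^sup>2 + 4 * ((L1_norm D h)\<^sup>2 - (norm h)\<^sup>2) * inverse (real N)"
        by (rule RGA_two_over_k_square_bound[OF assms h fs N]) }
    note bound = this
    show "norm (f - fs N) \<le> K_functional D f (2 * real N powr (-1/2))"
      unfolding t_def[symmetric]
    proof (rule K_functional_greatest)
      fix h assume h: "h \<in> L1_space D"
      let ?e = "norm (f - h)" and ?L = "L1_norm D h"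
      have L: "0 \<le> ?L" by (rule L1_norm_nonneg[OF h])
      have "(norm (f - fs N))\<^sup>2 \<le> ?e\<^sup>2 + 4 * (?L\<^sup>2 - (norm h)\<^sup>2) * t\<^sup>2"
        using bound[OF h] by (simp add: t)
      \<comment> \<open>Discarding \<open>(norm h)\<^sup>2\<close> leaves a sum of two squares, at
        most the square of the sum since both terms are nonnegative.\<close>
      also have "\<dots> \<le> ?e\<^sup>2 + (2 * t * ?L)\<^sup>2"
        by (simp add: power_mult_distrib algebra_simps)
      also have "\<dots> \<le> (?e + 2 * t * ?L)\<^sup>2"
        using t L by (simp add: power2_sum)
      finally show "norm (f - fs N) \<le> ?e + 2 * t * ?L"
        by (rule power2_le_imp_le) (use t L in simp)
    qed
    show "K_functional D f (2 * real N powr (-1/2)) \<le> 2 * K_functional D f (real N powr (-1/2))"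
      by (rule K_functional_double) simp }
  { fix fs assume fs: "RGA_sequence D (\<lambda>k. 1 - 1 / real k) f fs"
    { fix h assume h: "h \<in> L1_space D"
      let ?B = "(L1_norm D h)\<^sup>2 - (norm h)\<^sup>2"
      \<comment> \<open>This puts a factor \<open>real N\<close> on both sides of the scaled bound,
        ready to be cancelled.\<close>
      have "real N * t = sqrt (real N)"
        unfolding t_eq by (simp add: real_div_sqrt)
      then have "sqrt (real N * ?B) = real N * (sqrt ?B * t)"
        by (metis mult.left_commute mult.commute real_sqrt_mult)
      then have "real N * norm (f - fs N) \<le> real N * (norm (f - h) + sqrt ?B * t)"
        using RGA_one_over_k_bound[OF assms h fs, of N] by (simp add: distrib_left)
      then show "norm (f - fs N) \<le> norm (f - h) + sqrt ?B * real N powr (-1/2)"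
        using N by (simp add: t_def) }
    note bound = this
    show "norm (f - fs N) \<le> K_functional D f (real N powr (-1/2))"
      unfolding t_def[symmetric]
    proof (rule K_functional_greatest)
      fix h assume h: "h \<in> L1_space D"
      \<comment> \<open>Dropping \<open>(norm h)\<^sup>2\<close> under the root leaves exactly the
        objective of the K-functional at \<open>t\<close>.\<close>
      have "sqrt ((L1_norm D h)\<^sup>2 - (norm h)\<^sup>2) \<le> L1_norm D h"
        by (intro real_le_lsqrt L1_norm_nonneg[OF h]) simp
      then have "sqrt ((L1_norm D h)\<^sup>2 - (norm h)\<^sup>2) * t \<le> t * L1_norm D h"
        using t by (simp add: mult.commute mult_left_mono)
      then show "norm (f - fs N) \<le> norm (f - h) + t * L1_norm D h"
        using bound[OF h] unfolding t_def[symmetric] by linarith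
    qed }
qed

end
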